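(* There exists a nonempty $\Pi^0_1$ (in particular closed) subset $Q \subseteq \mathbb{N}^{\mathbb{N}}$ of Baire space such that $Q$ is not compact and any two distinct elements of $Q$ are Turing incomparable; that is, for all $f, g \in Q$ with $f \neq g$, we have $f \not\leq_T g$.
   Context: Baire space $\mathbb{N}^{\mathbb{N}}$ is the set of all functions from $\mathbb{N}$ to $\mathbb{N}$ with the topology generated by the basic open sets $[\sigma] = \{f : \sigma \subseteq f\}$ for finite sequences $\sigma \in \mathbb{N}^{<\mathbb{N}}$ (where $\sigma \subseteq f$ means $\sigma$ is an initial segment of $f$). A set $Q \subseteq \mathbb{N}^{\mathbb{N}}$ is $\Pi^0_1$ (effectively closed) if $Q = [T]$ is the set of infinite paths through some computable tree $T \subseteq \mathbb{N}^{<\mathbb{N}}$. $f \leq_T g$ means $f$ is Turing reducible to $g$. *)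

theory Defs
  imports
    "HOL-Analysis.Abstract_Topology"
    "HOL-Library.Nat_Bijection"
    "HOL-Library.Sublist"
begin

section \<open>Oracle computation\<close>

text \<open>
  Kleene's \<mu>-recursive functions with an additional initial function for the oracle.
  The oracle is a partial function, so that the empty map gives computation without an oracle
  and \<open>Some \<circ> g\<close> gives computation relative to the total function \<open>g\<close>.
  \<open>computes A e xs y\<close> means that program \<open>e\<close> with oracle \<open>A\<close> halts on the argument
  tuple \<open>xs\<close> with value \<open>y\<close>.
\<close>

datatype prog =
    Zero
  | Succ
  | Proj nat
  | Oracle
  | Comp prog "prog list"
  | PrimRec prog prog
  | Mu prog

inductive computes :: "(nat \<rightharpoonup> nat) \<Rightarrow> prog \<Rightarrow> nat list \<Rightarrow> nat \<Rightarrow> bool"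
  for A :: "nat \<rightharpoonup> nat"
where
  Zero: "computes A Zero xs 0"
| Succ: "computes A Succ [x] (Suc x)"
| Proj: "i < length xs \<Longrightarrow> computes A (Proj i) xs (xs ! i)"
| Oracle: "A x = Some y \<Longrightarrow> computes A Oracle [x] y"
| Comp: "list_all2 (\<lambda>d y. computes A d xs y) ds ys \<Longrightarrow> computes A e ys z
    \<Longrightarrow> computes A (Comp e ds) xs z"
| PrimRec_0: "computes A d xs y \<Longrightarrow> computes A (PrimRec d e) (0 # xs) y"
| PrimRec_Suc: "computes A (PrimRec d e) (n # xs) y \<Longrightarrow> computes A e (n # y # xs) z
    \<Longrightarrow> computes A (PrimRec d e) (Suc n # xs) z"
| Mu: "computes A e (n # xs) 0 \<Longrightarrow> (\<forall>m<n. \<exists>k. computes A e (m # xs) (Suc k))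
    \<Longrightarrow> computes A (Mu e) xs n"

inductive_cases computes_ZeroE: "computes A Zero xs y"
inductive_cases computes_SuccE: "computes A Succ xs y"
inductive_cases computes_ProjE: "computes A (Proj i) xs y"
inductive_cases computes_OracleE: "computes A Oracle xs y"
inductive_cases computes_CompE: "computes A (Comp e ds) xs y"
inductive_cases computes_PrimRec_0E: "computes A (PrimRec d e) (0 # xs) y"
inductive_cases computes_PrimRec_SucE: "computes A (PrimRec d e) (Suc n # xs) y"
inductive_cases computes_MuE: "computes A (Mu e) xs y"

lemma computes_deterministic:
  "computes A e xs y \<Longrightarrow> computes A e xs z \<Longrightarrow> y = z"
proof (induction arbitrary: z rule: computes.induct)
  case (Zero xs)
  then show ?case by (auto elim: computes_ZeroE)
next
  case (Succ x)
  then show ?case by (auto elim: computes_SuccE)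
next
  case (Proj i xs)
  then show ?case by (auto elim: computes_ProjE)
next
  case (Oracle x y)
  then show ?case by (auto elim: computes_OracleE)
next
  case (Comp xs ds ys e y)
  from Comp.prems obtain ys' where ys': "list_all2 (\<lambda>d y. computes A d xs y) ds ys'"
    and z: "computes A e ys' z"
    by (rule computes_CompE)
  have "ys = ys'"
    using Comp.IH(1) ys' by (auto simp: list_all2_conv_all_nth intro: nth_equalityI)
  with z Comp.IH(2) show ?case by simp
next
  case (PrimRec_0 d xs y e)
  from PrimRec_0.prems have "computes A d xs z"
    by (rule computes_PrimRec_0E)
  then show ?case by (rule PrimRec_0.IH)
next
  case (PrimRec_Suc d e n xs y w)
  from PrimRec_Suc.prems obtain y' where y': "computes A (PrimRec d e) (n # xs) y'"
    and z: "computes A e (n # y' # xs) z"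
    by (rule computes_PrimRec_SucE)
  from PrimRec_Suc.IH(1)[OF y'] z show ?case by (auto intro: PrimRec_Suc.IH(2))
next
  case (Mu e n xs)
  from Mu.prems obtain z0: "computes A e (z # xs) 0"
    and zs: "\<forall>m<z. \<exists>k. computes A e (m # xs) (Suc k)"
    by (rule computes_MuE)
  have "\<not> z < n"
  proof
    assume "z < n"
    then obtain k where "\<forall>w. computes A e (z # xs) w \<longrightarrow> Suc k = w"
      using Mu.IH(2) by blast
    with z0 show False by blast
  qed
  moreover have "\<not> n < z"
  proof
    assume "n < z"
    then obtain k where "computes A e (n # xs) (Suc k)"
      using zs by blast
    with Mu.IH(1) show False by blast
  qed
  ultimately show ?case by simp
qed

definition computable :: "(nat \<Rightarrow> nat) \<Rightarrow> bool" where
  "computable f \<longleftrightarrow> (\<exists>e. \<forall>x. computes Map.empty e [x] (f x))"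

definition turing_le :: "(nat \<Rightarrow> nat) \<Rightarrow> (nat \<Rightarrow> nat) \<Rightarrow> bool" (infix "\<le>\<^sub>T" 50) where
  "f \<le>\<^sub>T g \<longleftrightarrow> (\<exists>e. \<forall>x. computes (Some \<circ> g) e [x] (f x))"

section \<open>Baire space and effectively closed sets\<close>

definition init_seg :: "nat list \<Rightarrow> (nat \<Rightarrow> nat) \<Rightarrow> bool" where
  "init_seg \<sigma> f \<longleftrightarrow> (\<forall>i < length \<sigma>. \<sigma> ! i = f i)"

definition cylinder :: "nat list \<Rightarrow> (nat \<Rightarrow> nat) set" where
  "cylinder \<sigma> = {f. init_seg \<sigma> f}"

definition baire_topology :: "(nat \<Rightarrow> nat) topology" where
  "baire_topology = topology_generated_by (range cylinder)"

lemma topspace_baire_topology [simp]: "topspace baire_topology = UNIV"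
proof -
  have "cylinder [] = UNIV"
    by (auto simp: cylinder_def init_seg_def)
  then show ?thesis
    by (auto simp: baire_topology_def)
qed

definition is_tree :: "nat list set \<Rightarrow> bool" where
  "is_tree T \<longleftrightarrow> (\<forall>\<sigma>\<in>T. \<forall>\<tau>. prefix \<tau> \<sigma> \<longrightarrow> \<tau> \<in> T)"

definition tree_paths :: "nat list set \<Rightarrow> (nat \<Rightarrow> nat) set" where
  "tree_paths T = {f. \<forall>\<sigma>. init_seg \<sigma> f \<longrightarrow> \<sigma> \<in> T}"

text \<open>Computability of a set of strings refers to the coding of strings by \<^const>\<open>list_encode\<close>.\<close>

definition computable_strings :: "nat list set \<Rightarrow> bool" where
  "computable_strings T \<longleftrightarrow> computable (\<lambda>n. if list_decode n \<in> T then 1 else 0)"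

definition Pi01_class :: "(nat \<Rightarrow> nat) set \<Rightarrow> bool" where
  "Pi01_class Q \<longleftrightarrow> (\<exists>T. is_tree T \<and> computable_strings T \<and> Q = tree_paths T)"

end

theory Submission
  imports Defs
begin

text \<open>
  The set \<open>Q\<close> is countable, \<open>Q = {f\<^sub>0, f\<^sub>1, \<dots>}\<close>, and non-compact because \<open>f\<^sub>n\<close> records
  \<open>n\<close> in its first value. A Kleene-Post construction produces a function \<open>G\<close> whose
  rows \<open>G\<^sub>n(x) = G(\<langle>n, x\<rangle>)\<close> are pairwise Turing incomparable: \<open>G\<close> is the union of strings
  \<open>\<sigma>\<^sub>0, \<sigma>\<^sub>1, \<dots>\<close>, where \<open>\<sigma>\<^sub>i\<^sub>+\<^sub>1\<close> is the extension of \<open>\<sigma>\<^sub>i\<close> with the least witness that the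
  \<open>i\<close>-th reduction fails, if there is one. If the search for a witness is cut off at \<open>t\<close>, one gets
  computable approximations \<open>\<sigma>\<^sub>i\<^sup>t\<close> that are eventually equal to \<open>\<sigma>\<^sub>i\<close>. Hence \<open>G\<^sub>n\<close> is the only
  \<open>X\<close> such that for every \<open>s\<close> there is \<open>t \<ge> s\<close> for which the \<open>n\<close>-th row of \<open>\<sigma>\<^sub>s\<^sup>t\<close> agrees with
  \<open>X\<close>. The least such \<open>t\<close> is computable from \<open>X\<close>, so adding it as a witness,
  \<open>f\<^sub>n(s) = \<langle>n, G\<^sub>n(s), t\<rangle>\<close>, turns this \<open>\<Pi>\<^sup>0\<^sub>2\<close> definition into a \<open>\<Pi>\<^sup>0\<^sub>1\<close> one
  without changing the Turing degree.
\<close>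

section \<open>Closure properties of recursive functions\<close>

text \<open>The type \<open>'c\<close> is a context of variables: \<open>vs\<close> lists the numbers that are read off a
  context and passed to the program. A bound variable is added by pairing it with the context.\<close>

definition recursive_in :: "(nat \<rightharpoonup> nat) \<Rightarrow> ('c \<Rightarrow> nat) list \<Rightarrow> ('c \<Rightarrow> nat) \<Rightarrow> bool" where
  "recursive_in A vs f \<longleftrightarrow> (\<exists>e. \<forall>c. computes A e (map (\<lambda>v. v c) vs) (f c))"

definition decidable_in :: "(nat \<rightharpoonup> nat) \<Rightarrow> ('c \<Rightarrow> nat) list \<Rightarrow> ('c \<Rightarrow> bool) \<Rightarrow> bool" where
  "decidable_in A vs P \<longleftrightarrow> recursive_in A vs (\<lambda>c. of_bool (P c))"

section \<open>Substitution and change of context\<close>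

lemma recursive_in_cong:
  "recursive_in A vs f \<Longrightarrow> (\<And>c. f c = g c) \<Longrightarrow> recursive_in A vs g"
  by (simp add: recursive_in_def)

lemma recursive_in_var:
  assumes "v \<in> set vs"
  shows "recursive_in A vs v"
proof -
  obtain i where "i < length vs" "vs ! i = v"
    using assms by (auto simp: in_set_conv_nth)
  then have "computes A (Proj i) (map (\<lambda>v. v c) vs) (v c)" for c
    using computes.Proj[of i "map (\<lambda>v. v c) vs" A] by simp
  then show ?thesis
    unfolding recursive_in_def by blast
qed

text \<open>The \<open>Comp\<close> constructor, stated for a map \<open>h\<close> between contexts
  of possibly different types. Only the values of the inner variables \<open>ws\<close> at
  \<open>h c\<close> have to be computed, and \<open>fs\<close> lists the functions that do
  so.\<close>

lemma recursive_in_subst: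
  assumes g: "recursive_in A ws g"
    and fs: "\<And>f. f \<in> set fs \<Longrightarrow> recursive_in A vs f"
    and h: "\<And>c. map (\<lambda>w. w (h c)) ws = map (\<lambda>f. f c) fs"
  shows "recursive_in A vs (\<lambda>c. g (h c))"
proof -
  obtain e where e: "computes A e (map (\<lambda>w. w d) ws) (g d)" for d
    using g unfolding recursive_in_def by blast
  obtain d where d: "computes A (d f) (map (\<lambda>v. v c) vs) (f c)" if "f \<in> set fs" for f c
    using fs unfolding recursive_in_def by metis
  have "computes A (Comp e (map d fs)) (map (\<lambda>v. v c) vs) (g (h c))" for c
  proof (rule computes.Comp)
    show "list_all2 (\<lambda>d. computes A d (map (\<lambda>v. v c) vs)) (map d fs) (map (\<lambda>f. f c) fs)"
      by (auto simp: list_all2_conv_all_nth d)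
    show "computes A e (map (\<lambda>f. f c) fs) (g (h c))"
      using e[of "h c"] h[of c] by simp
  qed
  then show ?thesis
    unfolding recursive_in_def by blast
qed

text \<open>Weakening. With \<open>r\<close> the projection \<open>fst\<close> it carries a function
  under a newly bound variable.\<close>

lemma recursive_in_lift:
  assumes "recursive_in A vs f"
    and "\<And>v. v \<in> set vs \<Longrightarrow> (\<lambda>d. v (r d)) \<in> set ws"
  shows "recursive_in A ws (\<lambda>d. f (r d))"
  by (rule recursive_in_subst[OF assms(1), of "map (\<lambda>v d. v (r d)) vs"])
    (auto simp: assms(2) intro: recursive_in_var)

lemma recursive_in_comp1:
  assumes "recursive_in A [\<lambda>x. x] F" "recursive_in A vs a"
  shows "recursive_in A vs (\<lambda>c. F (a c))"
  using assms by (intro recursive_in_subst[OF assms(1), of "[a]"]) auto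

lemma recursive_in_comp2:
  assumes "recursive_in A [fst, snd] (\<lambda>p. F (fst p) (snd p))"
    and "recursive_in A vs a" "recursive_in A vs b"
  shows "recursive_in A vs (\<lambda>c. F (a c) (b c))"
  using assms(2,3) recursive_in_subst[OF assms(1), of "[a, b]" vs "\<lambda>c. (a c, b c)"] by auto

lemma recursive_in_comp3:
  assumes "recursive_in A [fst, \<lambda>p. fst (snd p), \<lambda>p. snd (snd p)]
      (\<lambda>p. F (fst p) (fst (snd p)) (snd (snd p)))"
    and "recursive_in A vs a" "recursive_in A vs b" "recursive_in A vs d"
  shows "recursive_in A vs (\<lambda>c. F (a c) (b c) (d c))"
  using assms(2-) recursive_in_subst[OF assms(1), of "[a, b, d]" vs "\<lambda>c. (a c, b c, d c)"] by auto

lemma recursive_in_comp4: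
  assumes "recursive_in A [fst, \<lambda>p. fst (snd p), \<lambda>p. fst (snd (snd p)), \<lambda>p. snd (snd (snd p))]
      (\<lambda>p. F (fst p) (fst (snd p)) (fst (snd (snd p))) (snd (snd (snd p))))"
    and "recursive_in A vs a" "recursive_in A vs b" "recursive_in A vs d" "recursive_in A vs e"
  shows "recursive_in A vs (\<lambda>c. F (a c) (b c) (d c) (e c))"
  using assms(2-) recursive_in_subst[OF assms(1), of "[a, b, d, e]" vs "\<lambda>c. (a c, b c, d c, e c)"]
  by auto

lemmas decidable_in_comp2 =
  recursive_in_comp2[where F = "\<lambda>x y. of_bool (F x y)" for F, folded decidable_in_def]
lemmas decidable_in_comp3 =
  recursive_in_comp3[where F = "\<lambda>x y z. of_bool (F x y z)" for F, folded decidable_in_def]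
lemmas decidable_in_comp4 =
  recursive_in_comp4[where F = "\<lambda>x y z u. of_bool (F x y z u)" for F, folded decidable_in_def]

section \<open>Primitive recursion, decidable predicates and arithmetic\<close>

lemma recursive_in_Suc:
  assumes "recursive_in A vs a"
  shows "recursive_in A vs (\<lambda>c. Suc (a c))"
  by (rule recursive_in_comp1[OF _ assms])
    (auto simp: recursive_in_def intro: computes.Succ)

lemma recursive_in_const: "recursive_in A vs (\<lambda>_. k)"
proof (induction k)
  case 0
  then show ?case by (auto simp: recursive_in_def intro: computes.Zero)
qed (rule recursive_in_Suc)

lemma recursive_in_oracle:
  assumes "recursive_in (Some \<circ> g) vs a"
  shows "recursive_in (Some \<circ> g) vs (\<lambda>c. g (a c))"
  by (rule recursive_in_comp1[OF _ assms])
    (auto simp: recursive_in_def intro!: exI[of _ Oracle] computes.Oracle)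

text \<open>The two variables put in front of \<open>vs\<close> are the counter and the previous
  value, in the order in which \<open>PrimRec\<close> hands them to its step program.\<close>

lemma recursive_in_rec_nat:
  assumes g: "recursive_in A vs g"
    and h: "recursive_in A ((\<lambda>p. fst (snd p)) # (\<lambda>p. snd (snd p)) # map (\<lambda>v p. v (fst p)) vs)
      (\<lambda>p. h (fst p) (fst (snd p)) (snd (snd p)))"
    and a: "recursive_in A vs a"
  shows "recursive_in A vs (\<lambda>c. rec_nat (g c) (h c) (a c))"
proof -
  obtain d where d: "computes A d (map (\<lambda>v. v c) vs) (g c)" for c
    using g unfolding recursive_in_def by blast
  obtain e where "\<forall>p. computes A e (map (\<lambda>v. v p)
      ((\<lambda>p. fst (snd p)) # (\<lambda>p. snd (snd p)) # map (\<lambda>v p. v (fst p)) vs))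
      (h (fst p) (fst (snd p)) (snd (snd p)))"
    using h unfolding recursive_in_def by blast
  then have e: "computes A e (n # y # map (\<lambda>v. v c) vs) (h c n y)" for n y c
    by (auto simp: comp_def dest: spec[of _ "(c, n, y)"])
  have "computes A (PrimRec d e) (n # map (\<lambda>v. v c) vs) (rec_nat (g c) (h c) n)" for n c
    by (induction n) (auto intro: computes.intros d e)
  then have "recursive_in A (snd # map (\<lambda>v p. v (fst p)) vs)
      (\<lambda>p. rec_nat (g (fst p)) (h (fst p)) (snd p))"
    unfolding recursive_in_def by (auto simp: comp_def)
  from recursive_in_subst[OF this, of "a # vs" vs "\<lambda>c. (c, a c)"] show ?thesis
    using a by (auto intro: recursive_in_var)
qed

lemma decidable_in_recursive_in:
  "decidable_in A vs P \<Longrightarrow> recursive_in A vs (\<lambda>c. of_bool (P c))"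
  by (simp add: decidable_in_def)

text \<open>Recursion on the truth value: 0 returns the base value \<open>g c\<close>, and the
  single step at 1 returns \<open>f c\<close>.\<close>

lemma recursive_in_if:
  assumes P: "decidable_in A vs P" and f: "recursive_in A vs f" and g: "recursive_in A vs g"
  shows "recursive_in A vs (\<lambda>c. if P c then f c else g c)"
proof (rule recursive_in_cong)
  show "recursive_in A vs (\<lambda>c. rec_nat (g c) (\<lambda>_ _. f c) (of_bool (P c)))"
    by (intro recursive_in_rec_nat g decidable_in_recursive_in P recursive_in_lift[OF f]) auto
qed auto

lemma decidable_in_not:
  assumes "decidable_in A vs P"
  shows "decidable_in A vs (\<lambda>c. \<not> P c)"
  unfolding decidable_in_def
  by (rule recursive_in_cong[OF recursive_in_if[OF assms recursive_in_const[of _ _ 0]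
        recursive_in_const[of _ _ 1]]]) auto

lemma decidable_in_conj:
  assumes "decidable_in A vs P" "decidable_in A vs Q"
  shows "decidable_in A vs (\<lambda>c. P c \<and> Q c)"
  unfolding decidable_in_def
  by (rule recursive_in_cong[OF recursive_in_if[OF assms(1)
        assms(2)[THEN decidable_in_recursive_in] recursive_in_const[of _ _ 0]]]) auto

lemma decidable_in_disj:
  assumes "decidable_in A vs P" "decidable_in A vs Q"
  shows "decidable_in A vs (\<lambda>c. P c \<or> Q c)"
  using decidable_in_not[OF decidable_in_conj[OF assms[THEN decidable_in_not]]] by simp

lemma decidable_in_imp:
  assumes "decidable_in A vs P" "decidable_in A vs Q"
  shows "decidable_in A vs (\<lambda>c. P c \<longrightarrow> Q c)"
  unfolding imp_conv_disj by (rule decidable_in_disj[OF decidable_in_not[OF assms(1)] assms(2)])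

lemma recursive_in_pred:
  assumes "recursive_in A vs a"
  shows "recursive_in A vs (\<lambda>c. a c - 1)"
proof (rule recursive_in_cong)
  show "recursive_in A vs (\<lambda>c. rec_nat 0 (\<lambda>n _. n) (a c))"
    by (intro recursive_in_rec_nat recursive_in_const assms recursive_in_var) auto
  have "rec_nat 0 (\<lambda>n _. n) n = n - 1" for n :: nat
    by (cases n) auto
  then show "rec_nat 0 (\<lambda>n _. n) (a c) = a c - 1" for c .
qed

lemma recursive_in_minus:
  assumes "recursive_in A vs a" "recursive_in A vs b"
  shows "recursive_in A vs (\<lambda>c. a c - b c)"
proof (rule recursive_in_cong)
  show "recursive_in A vs (\<lambda>c. rec_nat (a c) (\<lambda>_ y. y - 1) (b c))"
    by (intro recursive_in_rec_nat recursive_in_pred assms recursive_in_var) auto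
  have "rec_nat x (\<lambda>_ y. y - 1) n = x - n" for x n :: nat
    by (induction n) auto
  then show "rec_nat (a c) (\<lambda>_ y. y - 1) (b c) = a c - b c" for c .
qed

lemma recursive_in_plus:
  assumes "recursive_in A vs a" "recursive_in A vs b"
  shows "recursive_in A vs (\<lambda>c. a c + b c)"
proof (rule recursive_in_cong)
  show "recursive_in A vs (\<lambda>c. rec_nat (a c) (\<lambda>_ y. Suc y) (b c))"
    by (intro recursive_in_rec_nat recursive_in_Suc assms recursive_in_var) auto
  have "rec_nat x (\<lambda>_ y. Suc y) n = x + n" for x n :: nat
    by (induction n) auto
  then show "rec_nat (a c) (\<lambda>_ y. Suc y) (b c) = a c + b c" for c .
qed

lemma decidable_in_le:
  assumes "recursive_in A vs a" "recursive_in A vs b"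
  shows "decidable_in A vs (\<lambda>c. a c \<le> b c)"
  unfolding decidable_in_def
proof (rule recursive_in_cong)
  show "recursive_in A vs (\<lambda>c. 1 - (a c - b c))"
    by (intro recursive_in_minus recursive_in_const assms)
qed auto

lemma decidable_in_less:
  assumes "recursive_in A vs a" "recursive_in A vs b"
  shows "decidable_in A vs (\<lambda>c. a c < b c)"
  using decidable_in_not[OF decidable_in_le[OF assms(2,1)]] by (simp add: not_le)

lemma decidable_in_eq:
  fixes a b :: "'c \<Rightarrow> nat"
  assumes "recursive_in A vs a" "recursive_in A vs b"
  shows "decidable_in A vs (\<lambda>c. a c = b c)"
  using decidable_in_conj[OF decidable_in_le[OF assms] decidable_in_le[OF assms(2,1)]]
  by (simp add: eq_iff)

section \<open>Minimization and bounded quantifiers\<close>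

text \<open>\<open>Mu\<close> stops at the first zero, so it is applied to a program for the
  negation of \<open>P\<close>. The assumption \<open>ex\<close> makes the search halt in every
  context.\<close>

lemma recursive_in_Least:
  assumes P: "decidable_in A (snd # map (\<lambda>v p. v (fst p)) vs) (\<lambda>p. P (fst p) (snd p))"
    and ex: "\<And>c. \<exists>i. P c i"
  shows "recursive_in A vs (\<lambda>c. LEAST i. P c i)"
proof -
  obtain e where "\<forall>p. computes A e (map (\<lambda>v. v p) (snd # map (\<lambda>v p. v (fst p)) vs))
      (of_bool (\<not> P (fst p) (snd p)))"
    using decidable_in_not[OF P] unfolding decidable_in_def recursive_in_def by blast
  then have e: "computes A e (i # map (\<lambda>v. v c) vs) (of_bool (\<not> P c i))" for i c
    by (auto simp: comp_def dest: spec[of _ "(c, i)"])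
  have "computes A (Mu e) (map (\<lambda>v. v c) vs) (LEAST i. P c i)" for c
  proof (rule computes.Mu)
    have "P c (LEAST i. P c i)"
      using ex by (rule LeastI_ex)
    then show "computes A e ((LEAST i. P c i) # map (\<lambda>v. v c) vs) 0"
      using e[of "LEAST i. P c i" c] by simp
    show "\<forall>m<LEAST i. P c i. \<exists>k. computes A e (m # map (\<lambda>v. v c) vs) (Suc k)"
    proof (intro allI impI exI)
      fix m assume "m < (LEAST i. P c i)"
      then have "\<not> P c m" by (rule not_less_Least)
      then show "computes A e (m # map (\<lambda>v. v c) vs) (Suc 0)"
        using e[of m c] by simp
    qed
  qed
  then show ?thesis
    unfolding recursive_in_def by blast
qed

text \<open>Adding the alternative \<open>b c \<le> i\<close> makes the search total; it ends below
  the bound exactly if a witness lies there.\<close>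

lemma decidable_in_ex_less:
  assumes b: "recursive_in A vs b"
    and P: "decidable_in A (snd # map (\<lambda>v p. v (fst p)) vs) (\<lambda>p. P (fst p) (snd p))"
  shows "decidable_in A vs (\<lambda>c. \<exists>i<b c. P c i)"
proof -
  have "recursive_in A vs (\<lambda>c. LEAST i. b c \<le> i \<or> P c i)"
    by (intro recursive_in_Least decidable_in_disj decidable_in_le P
        recursive_in_lift[OF b] recursive_in_var) auto
  then have "decidable_in A vs (\<lambda>c. (LEAST i. b c \<le> i \<or> P c i) < b c)"
    by (intro decidable_in_less b)
  moreover have "((LEAST i. n \<le> i \<or> Q i) < n) = (\<exists>i<n. Q i)" for n :: nat and Q
  proof
    assume "(LEAST i. n \<le> i \<or> Q i) < n"
    then show "\<exists>i<n. Q i"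
      using LeastI[of "\<lambda>i. n \<le> i \<or> Q i" n] by auto
  qed (auto intro: le_less_trans[OF Least_le])
  ultimately show ?thesis by simp
qed

lemma decidable_in_all_less:
  assumes b: "recursive_in A vs b"
    and P: "decidable_in A (snd # map (\<lambda>v p. v (fst p)) vs) (\<lambda>p. P (fst p) (snd p))"
  shows "decidable_in A vs (\<lambda>c. \<forall>i<b c. P c i)"
  using decidable_in_not[OF decidable_in_ex_less[OF b decidable_in_not[OF P]]] by simp

lemmas recursive_intros =
  recursive_in_const recursive_in_Suc recursive_in_if recursive_in_minus recursive_in_plus
  decidable_in_not decidable_in_conj decidable_in_disj decidable_in_imp
  decidable_in_le decidable_in_less decidable_in_eq
  decidable_in_ex_less decidable_in_all_less

section \<open>Pairing and its projections\<close>

lemma recursive_in_prod_encode: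
  assumes "recursive_in A vs a" "recursive_in A vs b"
  shows "recursive_in A vs (\<lambda>c. prod_encode (a c, b c))"
proof -
  have tri: "triangle n = rec_nat 0 (\<lambda>n y. y + Suc n) n" for n
    by (induction n) auto
  have "recursive_in A [\<lambda>x. x] triangle"
    unfolding tri
    by (intro recursive_in_rec_nat recursive_intros recursive_in_var) auto
  from recursive_in_plus[OF recursive_in_comp1[OF this recursive_in_plus[OF assms]] assms(1)]
  show ?thesis
    by (simp add: prod_encode_def)
qed

definition pi1 :: "nat \<Rightarrow> nat" where "pi1 n = fst (prod_decode n)"
definition pi2 :: "nat \<Rightarrow> nat" where "pi2 n = snd (prod_decode n)"

lemma pi_prod_encode [simp]: "pi1 (prod_encode (a, b)) = a" "pi2 (prod_encode (a, b)) = b"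
  by (simp_all add: pi1_def pi2_def)

lemma prod_encode_pi [simp]: "prod_encode (pi1 n, pi2 n) = n"
  by (simp add: pi1_def pi2_def)

text \<open>Lets the formulas for head and tail of a list code hold for the empty list too: its code
  0 has predecessor 0, so the tail is empty and the default entry is 0.\<close>

lemma pi_0 [simp]: "pi1 0 = 0" "pi2 0 = 0"
proof -
  have "prod_encode (0, 0) = 0"
    by (simp add: prod_encode_def)
  then show "pi1 0 = 0" "pi2 0 = 0"
    by (metis pi_prod_encode(1), metis pi_prod_encode(2))
qed

text \<open>Inverts the pairing by search. The inner bound suffices because a pair code is at least
  as large as its components.\<close>

lemma pi1_eq_Least: "pi1 n = (LEAST a. \<exists>b<Suc n. prod_encode (a, b) = n)"
proof (rule Least_equality[symmetric])
  show "\<exists>b<Suc n. prod_encode (pi1 n, b) = n"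
    using le_prod_encode_2[of "pi2 n" "pi1 n"] by (intro exI[of _ "pi2 n"]) auto
qed auto

lemma pi2_eq_Least: "pi2 n = (LEAST b. prod_encode (pi1 n, b) = n)"
proof (rule Least_equality[symmetric])
  show "pi2 n \<le> b" if "prod_encode (pi1 n, b) = n" for b
    using arg_cong[OF that, of pi2] by simp
qed simp

lemma recursive_in_pi1:
  assumes "recursive_in A vs a"
  shows "recursive_in A vs (\<lambda>c. pi1 (a c))"
proof (rule recursive_in_comp1[OF _ assms])
  show "recursive_in A [\<lambda>x. x] pi1"
    unfolding pi1_eq_Least
  proof (intro recursive_in_Least recursive_intros recursive_in_prod_encode recursive_in_var)
    fix n show "\<exists>a. \<exists>b<Suc n. prod_encode (a, b) = n"
      using le_prod_encode_2[of "pi2 n" "pi1 n"] by (intro exI[of _ "pi1 n"] exI[of _ "pi2 n"]) auto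
  qed auto
qed

lemma recursive_in_pi2:
  assumes "recursive_in A vs a"
  shows "recursive_in A vs (\<lambda>c. pi2 (a c))"
proof (rule recursive_in_comp1[OF _ assms])
  show "recursive_in A [\<lambda>x. x] pi2"
    unfolding pi2_eq_Least
  proof (intro recursive_in_Least recursive_intros recursive_in_prod_encode recursive_in_pi1
      recursive_in_var)
    fix n show "\<exists>b. prod_encode (pi1 n, b) = n"
      by (rule exI[of _ "pi2 n"]) simp
  qed auto
qed

section \<open>Operations on codes of lists\<close>

definition list_drop :: "nat \<Rightarrow> nat \<Rightarrow> nat" where
  "list_drop k n = list_encode (drop k (list_decode n))"

definition list_len :: "nat \<Rightarrow> nat" where
  "list_len n = length (list_decode n)"

definition list_nth :: "nat \<Rightarrow> nat \<Rightarrow> nat" where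
  "list_nth n k = (if k < list_len n then list_decode n ! k else 0)"

lemma list_drop_list_encode [simp]: "list_drop k (list_encode xs) = list_encode (drop k xs)"
  by (simp add: list_drop_def)

lemma list_decode_list_drop [simp]: "list_decode (list_drop k n) = drop k (list_decode n)"
  by (simp add: list_drop_def)

lemma list_len_list_encode [simp]: "list_len (list_encode xs) = length xs"
  by (simp add: list_len_def)

lemma list_nth_list_encode [simp]: "k < length xs \<Longrightarrow> list_nth (list_encode xs) k = xs ! k"
  by (simp add: list_nth_def)

lemma list_encode_tl: "list_encode (tl xs) = pi2 (list_encode xs - 1)"
  by (cases xs) auto

lemma recursive_in_list_drop:
  assumes "recursive_in A vs a" "recursive_in A vs b"
  shows "recursive_in A vs (\<lambda>c. list_drop (a c) (b c))"
proof -
  have "list_drop k n = rec_nat n (\<lambda>_ y. pi2 (y - 1)) k" for k n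
  proof (induction k)
    case (Suc k)
    have "list_drop (Suc k) n = list_encode (tl (drop k (list_decode n)))"
      by (simp add: list_drop_def drop_Suc tl_drop)
    also have "\<dots> = pi2 (list_drop k n - 1)"
      by (simp only: list_encode_tl list_drop_def)
    finally show ?case
      using Suc by simp
  qed (simp add: list_drop_def)
  moreover have "recursive_in A vs (\<lambda>c. rec_nat (b c) (\<lambda>_ y. pi2 (y - 1)) (a c))"
    by (intro recursive_in_rec_nat recursive_intros recursive_in_pi2 assms recursive_in_var) auto
  ultimately show ?thesis
    by simp
qed

lemma list_encode_eq_0_iff [simp]: "list_encode xs = 0 \<longleftrightarrow> xs = []"
  by (cases xs) auto

lemma list_len_eq_Least: "list_len n = (LEAST k. list_drop k n = 0)"
  by (rule Least_equality[symmetric]) (auto simp: list_drop_def list_len_def)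

lemma recursive_in_list_len:
  assumes "recursive_in A vs a"
  shows "recursive_in A vs (\<lambda>c. list_len (a c))"
proof (rule recursive_in_comp1[OF _ assms])
  show "recursive_in A [\<lambda>x. x] list_len"
    unfolding list_len_eq_Least
  proof (intro recursive_in_Least recursive_intros recursive_in_list_drop recursive_in_var)
    fix n show "\<exists>k. list_drop k n = 0"
      by (auto simp: list_drop_def intro: exI[of _ "length (list_decode n)"])
  qed auto
qed

lemma recursive_in_list_nth:
  assumes "recursive_in A vs a" "recursive_in A vs b"
  shows "recursive_in A vs (\<lambda>c. list_nth (a c) (b c))"
proof -
  have "list_nth n k = pi1 (list_drop k n - 1)" for k n
  proof (cases "k < list_len n")
    case True
    then show ?thesis
      by (auto simp: list_nth_def list_drop_def list_len_def Cons_nth_drop_Suc[symmetric])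
  next
    case False
    then show ?thesis
      by (auto simp: list_nth_def list_drop_def list_len_def)
  qed
  then show ?thesis
    by (auto intro!: recursive_intros recursive_in_pi1 recursive_in_list_drop assms)
qed

definition list_cons :: "nat \<Rightarrow> nat \<Rightarrow> nat" where
  "list_cons k n = list_encode (k # list_decode n)"

lemma list_cons_list_encode [simp]: "list_cons k (list_encode xs) = list_encode (k # xs)"
  by (simp add: list_cons_def)

lemma recursive_in_list_cons:
  assumes "recursive_in A vs a" "recursive_in A vs b"
  shows "recursive_in A vs (\<lambda>c. list_cons (a c) (b c))"
  by (auto simp: list_cons_def intro!: recursive_intros recursive_in_prod_encode assms)

lemma bex_list_decode_iff: "(\<exists>x\<in>set (list_decode n). P x) \<longleftrightarrow> (\<exists>i<list_len n. P (list_nth n i))"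
  using list_ex_length[of P "list_decode n"]
  by (simp add: list_ex_iff list_len_def list_nth_def cong: conj_cong)

lemma decidable_in_mem:
  assumes "recursive_in A vs a" "recursive_in A vs b"
  shows "decidable_in A vs (\<lambda>c. a c \<in> set (list_decode (b c)))"
proof -
  have *: "x \<in> set (list_decode n) \<longleftrightarrow> (\<exists>i<list_len n. x = list_nth n i)" for x n
    using bex_list_decode_iff[of n "\<lambda>y. x = y"] by simp
  show ?thesis
    unfolding *
    by (rule decidable_in_comp2[OF _ assms], intro recursive_intros recursive_in_list_nth
        recursive_in_list_len recursive_in_var) auto
qed

lemma decidable_in_bex:
  assumes a: "recursive_in A vs a"
    and P: "decidable_in A (snd # map (\<lambda>v p. v (fst p)) vs) (\<lambda>p. P (fst p) (snd p))"
  shows "decidable_in A vs (\<lambda>c. \<exists>x\<in>set (list_decode (a c)). P c x)"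
  unfolding bex_list_decode_iff
proof (intro decidable_in_ex_less recursive_in_list_len a)
  \<comment> \<open>The redundant pairs display the function as the predicate in \<open>P\<close>
    composed with the context map that replaces an index by the list entry at that index.\<close>
  have "recursive_in A (snd # map (\<lambda>v p. v (fst p)) vs)
      (\<lambda>p. of_bool (P (fst (fst p, list_nth (a (fst p)) (snd p))) (snd (fst p, list_nth (a (fst p)) (snd p)))))"
    by (rule recursive_in_subst[OF P[unfolded decidable_in_def],
          of "(\<lambda>p. list_nth (a (fst p)) (snd p)) # map (\<lambda>v p. v (fst p)) vs"])
      (auto intro!: recursive_in_list_nth recursive_in_lift[OF a] intro: recursive_in_var)
  then show "decidable_in A (snd # map (\<lambda>v p. v (fst p)) vs)
      (\<lambda>p. P (fst p) (list_nth (a (fst p)) (snd p)))"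
    by (simp add: decidable_in_def)
qed

lemmas recursive_list_intros =
  recursive_intros recursive_in_prod_encode recursive_in_pi1 recursive_in_pi2
  recursive_in_list_drop recursive_in_list_len recursive_in_list_nth recursive_in_list_cons
  decidable_in_mem decidable_in_bex

declare list_encode.simps [simp del]

section \<open>Arithmetization of computations\<close>

primrec prog_code :: "prog \<Rightarrow> nat" where
  "prog_code Zero = prod_encode (0, 0)"
| "prog_code Succ = prod_encode (1, 0)"
| "prog_code (Proj i) = prod_encode (2, i)"
| "prog_code Oracle = prod_encode (3, 0)"
| "prog_code (Comp e ds) = prod_encode (4, prod_encode (prog_code e, list_encode (map prog_code ds)))"
| "prog_code (PrimRec d e) = prod_encode (5, prod_encode (prog_code d, prog_code e))"
| "prog_code (Mu e) = prod_encode (6, prog_code e)"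

text \<open>An assertion that program \<open>e\<close> sends the tuple \<open>xs\<close> to
  \<open>y\<close>, as one number. It may be false, and \<open>e\<close> need not code a
  program.\<close>

definition claim :: "nat \<Rightarrow> nat \<Rightarrow> nat \<Rightarrow> nat" where
  "claim e xs y = prod_encode (e, prod_encode (xs, y))"

definition claim_prog :: "nat \<Rightarrow> nat" where "claim_prog c = pi1 c"
definition claim_args :: "nat \<Rightarrow> nat" where "claim_args c = pi1 (pi2 c)"
definition claim_val :: "nat \<Rightarrow> nat" where "claim_val c = pi2 (pi2 c)"

lemma claim_simps [simp]:
  "claim_prog (claim e xs y) = e" "claim_args (claim e xs y) = xs" "claim_val (claim e xs y) = y"
  by (simp_all add: claim_def claim_prog_def claim_args_def claim_val_def)

lemma claim_eq_iff: "c = claim e xs y \<longleftrightarrow> claim_prog c = e \<and> claim_args c = xs \<and> claim_val c = y"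
  by (auto simp: claim_def claim_prog_def claim_args_def claim_val_def)

text \<open>The seven disjuncts are the introduction rules of \<^const>\<open>computes\<close>, with premises in \<open>S\<close>.
  Numbers that code no program are harmless, so programs need not be decoded.\<close>

definition justified :: "(nat \<rightharpoonup> nat) \<Rightarrow> nat set \<Rightarrow> nat \<Rightarrow> bool" where
  "justified A S c \<longleftrightarrow>
    (pi1 (claim_prog c) = 0 \<and> claim_val c = 0) \<or>
    (pi1 (claim_prog c) = 1 \<and> list_len (claim_args c) = 1 \<and>
      claim_val c = Suc (list_nth (claim_args c) 0)) \<or>
    (pi1 (claim_prog c) = 2 \<and> pi2 (claim_prog c) < list_len (claim_args c) \<and>
      claim_val c = list_nth (claim_args c) (pi2 (claim_prog c))) \<or>
    (pi1 (claim_prog c) = 3 \<and> list_len (claim_args c) = 1 \<and>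
      A (list_nth (claim_args c) 0) = Some (claim_val c)) \<or>
    (pi1 (claim_prog c) = 4 \<and>
      (\<exists>b\<in>S. claim_prog b = pi1 (pi2 (claim_prog c)) \<and> claim_val b = claim_val c \<and>
        list_len (claim_args b) = list_len (pi2 (pi2 (claim_prog c))) \<and>
        (\<forall>k<list_len (claim_args b).
          claim (list_nth (pi2 (pi2 (claim_prog c))) k) (claim_args c) (list_nth (claim_args b) k) \<in> S))) \<or>
    (pi1 (claim_prog c) = 5 \<and> 0 < list_len (claim_args c) \<and>
      ((list_nth (claim_args c) 0 = 0 \<and>
        claim (pi1 (pi2 (claim_prog c))) (list_drop 1 (claim_args c)) (claim_val c) \<in> S) \<or>
       (0 < list_nth (claim_args c) 0 \<and>
        (\<exists>b\<in>S. claim_prog b = claim_prog c \<and>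
          claim_args b = list_cons (list_nth (claim_args c) 0 - 1) (list_drop 1 (claim_args c)) \<and>
          claim (pi2 (pi2 (claim_prog c))) (list_cons (list_nth (claim_args c) 0 - 1)
            (list_cons (claim_val b) (list_drop 1 (claim_args c)))) (claim_val c) \<in> S)))) \<or>
    (pi1 (claim_prog c) = 6 \<and>
      claim (pi2 (claim_prog c)) (list_cons (claim_val c) (claim_args c)) 0 \<in> S \<and>
      (\<forall>m<claim_val c. \<exists>b\<in>S. claim_prog b = pi2 (claim_prog c) \<and>
        claim_args b = list_cons m (claim_args c) \<and> 0 < claim_val b))"

section \<open>Soundness and completeness of derivations\<close>

text \<open>Premises stand behind their conclusions, so that list induction removes the last
  conclusion first.\<close>

primrec derivation :: "(nat \<rightharpoonup> nat) \<Rightarrow> nat list \<Rightarrow> bool" where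
  "derivation A [] \<longleftrightarrow> True"
| "derivation A (c # P) \<longleftrightarrow> justified A (set P) c \<and> derivation A P"

text \<open>\<open>S\<close> occurs only positively, so the monotonicity rules of the connectives
  suffice once the bounded quantifiers are unfolded.\<close>

lemma justified_mono:
  assumes "justified A S c" "S \<subseteq> S'"
  shows "justified A S' c"
proof -
  have "justified A S c \<longrightarrow> justified A S' c"
    unfolding justified_def Bex_def
    by (intro imp_refl in_mono[OF assms(2)] disj_mono conj_mono ex_mono all_mono imp_mono)
  with assms(1) show ?thesis by simp
qed

lemma justified_oracle_cong:
  assumes "justified A S c"
    and "\<And>y. A (list_nth (claim_args c) 0) = Some y \<Longrightarrow> B (list_nth (claim_args c) 0) = Some y"
  shows "justified B S c"
  using assms unfolding justified_def by blast

text \<open>The use principle: a derivation can query its oracle only at the first arguments of its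
  finitely many claims. It moves derivations between total oracles and columns of finite
  strings.\<close>

lemma derivation_oracle_cong:
  assumes "derivation A P"
    and "\<And>c y. c \<in> set P \<Longrightarrow> A (list_nth (claim_args c) 0) = Some y \<Longrightarrow>
      B (list_nth (claim_args c) 0) = Some y"
  shows "derivation B P"
  using assms by (induction P) (auto intro: justified_oracle_cong)

lemma derivation_append: "derivation A P \<Longrightarrow> derivation A P' \<Longrightarrow> derivation A (P @ P')"
  by (induction P) (auto intro: justified_mono)

text \<open>Induction on the list. The tag of \<open>prog_code p\<close> selects the one disjunct of
  \<open>justified\<close> that belongs to the constructor of \<open>p\<close>, and the premises of
  that disjunct lie in the tail.\<close>

lemma derivation_sound:
  assumes "derivation A P" "claim (prog_code p) (list_encode xs) y \<in> set P"
  shows "computes A p xs y"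
  using assms
proof (induction P arbitrary: p xs y)
  case Nil
  then show ?case by simp
next
  case (Cons c P)
  show ?case
  proof (cases "claim (prog_code p) (list_encode xs) y \<in> set P")
    case True
    then show ?thesis using Cons by simp
  next
    case False
    then have j: "justified A (set P) (claim (prog_code p) (list_encode xs) y)"
      using Cons.prems by auto
    have IH: "computes A p' xs' y'" if "claim (prog_code p') (list_encode xs') y' \<in> set P" for p' xs' y'
      using that Cons by simp
    \<comment> \<open>Some premises are given as a member \<open>b\<close> known only through its
      projections; this form of the hypothesis applies to them.\<close>
    have IH': "computes A p' xs' (claim_val b)"
      if "b \<in> set P" "claim_prog b = prog_code p'" "claim_args b = list_encode xs'" for p' xs' b
    proof (rule IH)
      have "b = claim (prog_code p') (list_encode xs') (claim_val b)"
        using that by (simp add: claim_eq_iff)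
      then show "claim (prog_code p') (list_encode xs') (claim_val b) \<in> set P"
        using that(1) by simp
    qed
    show ?thesis
    proof (cases p)
      case Zero
      then show ?thesis using j by (auto simp: justified_def intro: computes.Zero)
    next
      case Succ
      then obtain x where "xs = [x]" "y = Suc x"
        using j by (auto simp: justified_def length_Suc_conv)
      then show ?thesis using Succ by (auto intro: computes.Succ)
    next
      case (Proj i)
      then have "i < length xs" "y = xs ! i"
        using j by (auto simp: justified_def)
      then show ?thesis using Proj by (auto intro: computes.Proj)
    next
      case Oracle
      then obtain x where "xs = [x]" "A x = Some y"
        using j by (auto simp: justified_def length_Suc_conv)
      then show ?thesis using Oracle by (auto intro: computes.Oracle)
    next
      case (Comp e ds)
      then obtain b where b: "b \<in> set P" "claim_prog b = prog_code e" "claim_val b = y"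
        "list_len (claim_args b) = length ds"
        "\<And>k. k < length ds \<Longrightarrow>
          claim (prog_code (ds ! k)) (list_encode xs) (list_nth (claim_args b) k) \<in> set P"
        using j by (auto simp: justified_def)
      \<comment> \<open>Every number codes a list, so the intermediate values can be read off the
        arguments of \<open>b\<close>.\<close>
      define ys where "ys = list_decode (claim_args b)"
      have args: "claim_args b = list_encode ys" by (simp add: ys_def)
      have "computes A e ys y"
        using IH'[OF b(1,2) args] b(3) by simp
      moreover have "list_all2 (\<lambda>d y. computes A d xs y) ds ys"
        using b(4,5) by (auto simp: list_all2_conv_all_nth args intro!: IH)
      ultimately show ?thesis
        using Comp by (auto intro: computes.Comp)
    next
      case (PrimRec d e)
      then obtain n zs where xs: "xs = n # zs"
        using j by (cases xs) (auto simp: justified_def)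
      show ?thesis
      proof (cases n)
        case 0
        then have "claim (prog_code d) (list_encode zs) y \<in> set P"
          using j xs PrimRec by (auto simp: justified_def)
        from IH[OF this] show ?thesis
          using 0 xs PrimRec by (auto intro: computes.PrimRec_0)
      next
        case (Suc k)
        then obtain b where b: "b \<in> set P" "claim_prog b = prog_code p"
          "claim_args b = list_encode (k # zs)"
          "claim (prog_code e) (list_encode (k # claim_val b # zs)) y \<in> set P"
          using j xs PrimRec by (auto simp: justified_def)
        show ?thesis
          using IH'[OF b(1-3)] IH[OF b(4)] xs Suc PrimRec by (auto intro: computes.PrimRec_Suc)
      qed
    next
      case (Mu e)
      then have 0: "computes A e (y # xs) 0"
        using j by (auto simp: justified_def intro!: IH)
      have "\<exists>k. computes A e (m # xs) (Suc k)" if less: "m < y" for m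
      proof -
        obtain b where b: "b \<in> set P" "claim_prog b = prog_code e"
          "claim_args b = list_encode (m # xs)" "0 < claim_val b"
          using j Mu less by (auto simp: justified_def)
        show ?thesis
          using IH'[OF b(1-3)] b(4) by (metis gr0_conv_Suc)
      qed
      with 0 show ?thesis
        using Mu by (auto intro: computes.Mu)
    qed
  qed
qed

definition derivable :: "(nat \<rightharpoonup> nat) \<Rightarrow> nat set" where
  "derivable A = {c. \<exists>P. derivation A P \<and> c \<in> set P}"

text \<open>Derivations can be concatenated, so finitely many derivable claims share one
  derivation.\<close>

lemma finite_derivable:
  assumes "finite F" "F \<subseteq> derivable A"
  shows "\<exists>P. derivation A P \<and> F \<subseteq> set P"
  using assms
proof (induction F rule: finite_induct)
  case empty
  then show ?case by (auto intro: exI[of _ "[]"])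
next
  case (insert c F)
  then obtain P P' where "derivation A P" "F \<subseteq> set P" "derivation A P'" "c \<in> set P'"
    by (auto simp: derivable_def)
  then show ?case
    by (intro exI[of _ "P @ P'"]) (auto intro: derivation_append)
qed

lemma derivableI:
  assumes "finite F" "F \<subseteq> derivable A" "justified A F c"
  shows "c \<in> derivable A"
proof -
  obtain P where "derivation A P" "F \<subseteq> set P"
    using finite_derivable[OF assms(1,2)] by blast
  then have "derivation A (c # P)"
    using assms(3) by (auto intro: justified_mono)
  then show ?thesis
    unfolding derivable_def by (auto intro!: exI[of _ "c # P"])
qed

text \<open>Each rule of \<open>computes\<close> has finitely many premises, so their derivations
  merge into one list, to which the conclusion is consed.\<close>

lemma derivation_complete:
  assumes "computes A p xs y"
  shows "claim (prog_code p) (list_encode xs) y \<in> derivable A"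
  using assms
proof (induction rule: computes.induct)
  case (Zero xs)
  show ?case by (rule derivableI[of "{}"]) (auto simp: justified_def)
next
  case (Succ x)
  show ?case by (rule derivableI[of "{}"]) (auto simp: justified_def)
next
  case (Proj i xs)
  then show ?case by (intro derivableI[of "{}"]) (auto simp: justified_def)
next
  case (Oracle x y)
  then show ?case
    by (intro derivableI[of "{}"]) (auto simp: justified_def)
next
  case (Comp xs ds ys e z)
  let ?b = "claim (prog_code e) (list_encode ys) z"
  let ?F = "insert ?b ((\<lambda>k. claim (prog_code (ds ! k)) (list_encode xs) (ys ! k)) ` {..<length ds})"
  have "length ys = length ds"
    using Comp by (auto simp: list_all2_conv_all_nth)
  then have "justified A ?F (claim (prog_code (Comp e ds)) (list_encode xs) z)"
    unfolding justified_def by auto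
  moreover have "?F \<subseteq> derivable A"
    using Comp by (auto simp: list_all2_conv_all_nth)
  ultimately show ?case
    by (intro derivableI[of ?F]) auto
next
  case (PrimRec_0 d xs y e)
  then show ?case
    by (intro derivableI[of "{claim (prog_code d) (list_encode xs) y}"])
      (auto simp: justified_def)
next
  case (PrimRec_Suc d e n xs y z)
  then show ?case
    by (intro derivableI[of "{claim (prog_code (PrimRec d e)) (list_encode (n # xs)) y,
          claim (prog_code e) (list_encode (n # y # xs)) z}"])
      (auto simp: justified_def)
next
  case (Mu e n xs)
  \<comment> \<open>Choosing one positive value for each \<open>m < n\<close> turns the premises of
    \<open>Mu\<close> into a finite set of claims.\<close>
  then obtain k where k: "\<And>m. m < n \<Longrightarrow>
      claim (prog_code e) (list_encode (m # xs)) (Suc (k m)) \<in> derivable A"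
    by metis
  let ?F = "insert (claim (prog_code e) (list_encode (n # xs)) 0)
    ((\<lambda>m. claim (prog_code e) (list_encode (m # xs)) (Suc (k m))) ` {..<n})"
  have "justified A ?F (claim (prog_code (Mu e)) (list_encode xs) n)"
    unfolding justified_def by (auto)
  moreover have "?F \<subseteq> derivable A"
    using Mu k by auto
  ultimately show ?case
    by (intro derivableI[of ?F]) auto
qed

section \<open>Decidability of derivations from finite oracles\<close>

text \<open>Replaces the recursion by a bounded quantifier, which the closure rules can
  treat.\<close>

lemma derivation_iff_nth:
  "derivation A P \<longleftrightarrow> (\<forall>k<length P. justified A (set (drop (Suc k) P)) (P ! k))"
  by (induction P) (auto simp: All_less_Suc2)

text \<open>Strings are stored in reverse, so that a condition is extended by consing and the
  position \<open>p\<close> of the string \<open>\<tau>\<close> is \<open>rev \<tau> ! p\<close>.\<close>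

definition column :: "nat list \<Rightarrow> nat \<Rightarrow> nat \<rightharpoonup> nat" where
  "column \<tau> n x = (if prod_encode (n, x) < length \<tau> then Some (rev \<tau> ! prod_encode (n, x)) else None)"

definition rev_nth_code :: "nat \<Rightarrow> nat \<Rightarrow> nat" where
  "rev_nth_code t p = list_nth t (list_len t - Suc p)"

lemma rev_nth_code: "p < list_len t \<Longrightarrow> rev_nth_code t p = rev (list_decode t) ! p"
  by (auto simp: rev_nth_code_def list_nth_def list_len_def rev_nth)

lemma recursive_in_rev_nth_code:
  assumes "recursive_in A vs a" "recursive_in A vs b"
  shows "recursive_in A vs (\<lambda>c. rev_nth_code (a c) (b c))"
  unfolding rev_nth_code_def by (intro recursive_list_intros assms)

lemma decidable_in_column:
  assumes "recursive_in A vs t" "recursive_in A vs n" "recursive_in A vs x" "recursive_in A vs y"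
  shows "decidable_in A vs (\<lambda>c. column (list_decode (t c)) (n c) (x c) = Some (y c))"
proof -
  have *: "column (list_decode t) n x = Some y \<longleftrightarrow>
      prod_encode (n, x) < list_len t \<and> rev_nth_code t (prod_encode (n, x)) = y" for t n x y
    using rev_nth_code[of "prod_encode (n, x)" t] by (auto simp: column_def list_len_def)
  show ?thesis
    unfolding * by (intro recursive_list_intros recursive_in_rev_nth_code assms)
qed

lemma recursive_in_claim:
  assumes "recursive_in A vs a" "recursive_in A vs b" "recursive_in A vs c"
  shows "recursive_in A vs (\<lambda>x. claim (a x) (b x) (c x))"
  unfolding claim_def by (intro recursive_list_intros assms)

lemma recursive_in_claim_projections:
  assumes "recursive_in A vs a"
  shows "recursive_in A vs (\<lambda>x. claim_prog (a x))" "recursive_in A vs (\<lambda>x. claim_args (a x))"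
    "recursive_in A vs (\<lambda>x. claim_val (a x))"
  unfolding claim_prog_def claim_args_def claim_val_def by (intro recursive_list_intros assms)+

text \<open>The oracle is a column of a finite string, so oracle answers are decidable from the code
  of the string. Passing first to plain variables spares lifting \<open>t\<close>, \<open>n\<close>,
  \<open>q\<close> and \<open>c\<close> under the quantifiers.\<close>

lemma decidable_in_justified:
  assumes "recursive_in A vs t" "recursive_in A vs n" "recursive_in A vs q" "recursive_in A vs c"
  shows "decidable_in A vs
    (\<lambda>x. justified (column (list_decode (t x)) (n x)) (set (list_decode (q x))) (c x))"
  unfolding justified_def
  by (rule decidable_in_comp4[OF _ assms],
      (intro recursive_list_intros decidable_in_column recursive_in_claim recursive_in_list_cons
        recursive_in_claim_projections recursive_in_var; auto)+)

lemma decidable_in_derivation: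
  assumes "recursive_in A vs t" "recursive_in A vs n" "recursive_in A vs q"
  shows "decidable_in A vs (\<lambda>x. derivation (column (list_decode (t x)) (n x)) (list_decode (q x)))"
proof -
  have *: "derivation B (list_decode q) \<longleftrightarrow> (\<forall>k<list_len q.
      justified B (set (list_decode (list_drop (Suc k) q))) (list_nth q k))" for B q
    by (simp add: derivation_iff_nth list_len_def list_nth_def)
  show ?thesis
    unfolding *
    by (rule decidable_in_comp3[OF _ assms],
      (intro recursive_list_intros decidable_in_justified recursive_in_var; auto)+)
qed

section \<open>The construction\<close>

text \<open>For \<open>i = \<langle>e, n, m\<rangle>\<close>, the list \<open>P\<close> derives from row \<open>n\<close> of \<open>\<tau>\<close> a value of program \<open>e\<close>
  that differs from row \<open>m\<close> of \<open>\<tau>\<close>.\<close>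

definition requirement :: "nat \<Rightarrow> nat list \<Rightarrow> nat list \<Rightarrow> bool" where
  "requirement i \<tau> P \<longleftrightarrow> derivation (column \<tau> (pi1 (pi2 i))) P \<and>
    (\<exists>c\<in>set P. claim_prog c = pi1 i \<and> list_len (claim_args c) = 1 \<and>
      prod_encode (pi2 (pi2 i), list_nth (claim_args c) 0) < length \<tau> \<and>
      column \<tau> (pi2 (pi2 i)) (list_nth (claim_args c) 0) \<noteq> Some (claim_val c))"

text \<open>A witness is a single number coding both an extension of \<open>\<sigma>\<close> and a
  derivation, so that one search finds both.\<close>

definition good :: "nat \<Rightarrow> nat list \<Rightarrow> nat \<Rightarrow> bool" where
  "good i \<sigma> w \<longleftrightarrow> suffix \<sigma> (list_decode (pi1 w)) \<and>
    requirement i (list_decode (pi1 w)) (list_decode (pi2 w))"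

text \<open>The alternative \<open>s \<le> w\<close> cuts the search off; its result is
  \<open>s\<close> exactly if no witness lies below \<open>s\<close>.\<close>

definition extend :: "nat \<Rightarrow> nat list \<Rightarrow> nat \<Rightarrow> nat list" where
  "extend i \<sigma> s =
    (if (LEAST w. s \<le> w \<or> good i \<sigma> w) < s
     then list_decode (pi1 (LEAST w. s \<le> w \<or> good i \<sigma> w)) else \<sigma>)"

text \<open>The additional 0 lengthens the string at every step, which makes the union of the limit
  strings total.\<close>

primrec stage :: "nat \<Rightarrow> nat \<Rightarrow> nat list" where
  "stage 0 s = []"
| "stage (Suc i) s = 0 # extend i (stage i s) s"

definition extend_limit :: "nat \<Rightarrow> nat list \<Rightarrow> nat list" where
  "extend_limit i \<sigma> = (if \<exists>w. good i \<sigma> w then list_decode (pi1 (LEAST w. good i \<sigma> w)) else \<sigma>)"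

primrec limit :: "nat \<Rightarrow> nat list" where
  "limit 0 = []"
| "limit (Suc i) = 0 # extend_limit i (limit i)"

section \<open>Computability of the stages\<close>

lemma decidable_in_suffix:
  assumes "recursive_in A vs a" "recursive_in A vs b"
  shows "decidable_in A vs (\<lambda>c. suffix (list_decode (a c)) (list_decode (b c)))"
proof -
  have *: "suffix (list_decode a) (list_decode b) \<longleftrightarrow> (\<exists>k<Suc (list_len b). list_drop k b = a)" for a b
  proof
    assume "suffix (list_decode a) (list_decode b)"
    then obtain zs where "list_decode b = zs @ list_decode a"
      by (auto simp: suffix_def)
    then show "\<exists>k<Suc (list_len b). list_drop k b = a"
      by (intro exI[of _ "length zs"]) (auto simp: list_drop_def list_len_def)
  qed (auto intro: suffix_drop)
  show ?thesis
    unfolding *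
    by (rule decidable_in_comp2[OF _ assms],
      (intro recursive_list_intros recursive_in_var; auto)+)
qed

lemma decidable_in_good:
  assumes "recursive_in A vs i" "recursive_in A vs s" "recursive_in A vs w"
  shows "decidable_in A vs (\<lambda>c. good (i c) (list_decode (s c)) (w c))"
  unfolding good_def requirement_def list_len_def[symmetric]
  by (rule decidable_in_comp3[OF _ assms],
    (intro recursive_list_intros decidable_in_suffix decidable_in_derivation decidable_in_column
      recursive_in_claim_projections recursive_in_var; auto)+)

lemma recursive_in_extend:
  assumes "recursive_in A vs i" "recursive_in A vs s" "recursive_in A vs t"
  shows "recursive_in A vs (\<lambda>c. list_encode (extend (i c) (list_decode (s c)) (t c)))"
proof -
  have *: "list_encode (extend i (list_decode s) t) =
      (if (LEAST w. t \<le> w \<or> good i (list_decode s) w) < t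
       then pi1 (LEAST w. t \<le> w \<or> good i (list_decode s) w) else s)" for i s t
    by (simp add: extend_def)
  show ?thesis
    unfolding *
    by (rule recursive_in_comp3[OF _ assms],
      (intro recursive_list_intros recursive_in_Least decidable_in_good recursive_in_var; auto)+)
qed

lemma recursive_in_stage:
  assumes "recursive_in A vs i" "recursive_in A vs s"
  shows "recursive_in A vs (\<lambda>c. list_encode (stage (i c) (s c)))"
proof -
  have *: "list_encode (stage i s) =
      rec_nat 0 (\<lambda>i y. list_cons 0 (list_encode (extend i (list_decode y) s))) i" for i s
  proof (induction i)
    case (Suc i)
    then show ?case
      by (simp del: list_cons_list_encode flip: Suc) simp
  qed simp
  show ?thesis
    unfolding *
    by (rule recursive_in_comp2[OF _ assms],
      (intro recursive_list_intros recursive_in_rec_nat recursive_in_extend recursive_in_var; auto)+)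
qed

definition stage_val :: "nat \<Rightarrow> nat \<Rightarrow> nat \<Rightarrow> nat" where
  "stage_val i s p = rev_nth_code (list_encode (stage i s)) p"

lemma stage_val: "p < length (stage i s) \<Longrightarrow> stage_val i s p = rev (stage i s) ! p"
  by (simp add: stage_val_def rev_nth_code)

lemma recursive_in_stage_val:
  assumes "recursive_in A vs i" "recursive_in A vs s" "recursive_in A vs p"
  shows "recursive_in A vs (\<lambda>c. stage_val (i c) (s c) (p c))"
  unfolding stage_val_def by (intro recursive_in_rev_nth_code recursive_in_stage assms)

lemma recursive_in_length_stage:
  assumes "recursive_in A vs i" "recursive_in A vs s"
  shows "recursive_in A vs (\<lambda>c. length (stage (i c) (s c)))"
  using recursive_in_list_len[OF recursive_in_stage[OF assms]] by simp

section \<open>Convergence of the stages\<close>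

lemma suffix_extend: "suffix \<sigma> (extend i \<sigma> s)"
proof -
  let ?w = "LEAST w. s \<le> w \<or> good i \<sigma> w"
  have "s \<le> ?w \<or> good i \<sigma> ?w"
    by (rule LeastI[of _ s]) simp
  then show ?thesis
    by (auto simp: extend_def good_def)
qed

lemma suffix_extend_limit: "suffix \<sigma> (extend_limit i \<sigma>)"
proof (cases "\<exists>w. good i \<sigma> w")
  case True
  then have "good i \<sigma> (LEAST w. good i \<sigma> w)"
    by (rule LeastI_ex)
  then have "suffix \<sigma> (list_decode (pi1 (LEAST w. good i \<sigma> w)))"
    by (subst (asm) good_def) simp
  then show ?thesis
    using True by (simp add: extend_limit_def)
qed (simp add: extend_limit_def)

lemma suffix_stage: "i \<le> j \<Longrightarrow> suffix (stage i s) (stage j s)"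
  by (induction j rule: dec_induct) (auto intro: suffix_order.trans suffix_extend suffix_ConsI)

lemma suffix_limit: "i \<le> j \<Longrightarrow> suffix (limit i) (limit j)"
  by (induction j rule: dec_induct) (auto intro: suffix_order.trans suffix_extend_limit suffix_ConsI)

lemma length_limit: "i \<le> length (limit i)"
proof (induction i)
  case (Suc i)
  then show ?case
    using suffix_length_le[OF suffix_extend_limit[of "limit i" i]] by simp
qed simp

text \<open>A cutoff beyond the least witness no longer affects the search; without a witness both
  sides are \<open>\<sigma>\<close>.\<close>

lemma extend_eventually_limit: "\<exists>t. \<forall>s\<ge>t. extend i \<sigma> s = extend_limit i \<sigma>"
proof (cases "\<exists>w. good i \<sigma> w")
  case True
  let ?w = "LEAST w. good i \<sigma> w"
  have "(LEAST w. s \<le> w \<or> good i \<sigma> w) = ?w" if "Suc ?w \<le> s" for s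
    using that LeastI_ex[OF True] by (intro Least_equality) (auto intro: Least_le)
  then show ?thesis
    using True by (intro exI[of _ "Suc ?w"]) (auto simp: extend_def extend_limit_def)
next
  case False
  then have "(LEAST w. s \<le> w \<or> good i \<sigma> w) = s" for s
    by (intro Least_equality) auto
  then show ?thesis
    using False by (auto simp: extend_def extend_limit_def)
qed

lemma stage_eventually_limit: "\<exists>t. \<forall>s\<ge>t. stage i s = limit i"
proof (induction i)
  case (Suc i)
  then obtain t where "\<forall>s\<ge>t. stage i s = limit i" by blast
  moreover obtain t' where "\<forall>s\<ge>t'. extend i (limit i) s = extend_limit i (limit i)"
    using extend_eventually_limit by blast
  ultimately show ?case
    by (intro exI[of _ "max t t'"]) auto
qed simp

lemma suffix_rev_nth: "suffix \<sigma> \<tau> \<Longrightarrow> p < length \<sigma> \<Longrightarrow> rev \<tau> ! p = rev \<sigma> ! p"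
  by (auto simp: suffix_def nth_append)

section \<open>The generic function and its incomparable rows\<close>

text \<open>By \<open>length_limit\<close>, \<open>limit (Suc p)\<close> is long enough to have a
  position \<open>p\<close>; longer limits have the same value there.\<close>

definition generic :: "nat \<Rightarrow> nat" where
  "generic p = rev (limit (Suc p)) ! p"

lemma rev_limit_nth:
  assumes "p < length (limit i)"
  shows "rev (limit i) ! p = generic p"
proof -
  have p: "p < length (limit (Suc p))"
    using length_limit[of "Suc p"] by simp
  show ?thesis
  proof (cases "i \<le> Suc p")
    case True
    then show ?thesis
      using suffix_rev_nth[OF suffix_limit assms, of "Suc p"] by (simp add: generic_def)
  next
    case False
    then show ?thesis
      using suffix_rev_nth[OF suffix_limit p, of i] by (simp add: generic_def)
  qed
qed

definition row :: "nat \<Rightarrow> nat \<Rightarrow> nat" where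
  "row n x = generic (prod_encode (n, x))"

lemma column_suffix_limit:
  assumes "suffix \<tau> (limit i)" "column \<tau> n x = Some y"
  shows "row n x = y"
proof -
  have p: "prod_encode (n, x) < length \<tau>" and y: "y = rev \<tau> ! prod_encode (n, x)"
    using assms(2) by (auto simp: column_def split: if_splits)
  then have "prod_encode (n, x) < length (limit i)"
    using suffix_length_le[OF assms(1)] by simp
  from rev_limit_nth[OF this] show ?thesis
    using suffix_rev_nth[OF assms(1) p] y by (simp add: row_def)
qed

text \<open>Requirement \<open>i\<close> defeats the reduction \<open>e\<close>. If a witness
  exists, the chosen string is part of the generic function and its disagreement persists. If none
  exists, the computations of the supposed reduction yield one.\<close>

lemma rows_incomparable:
  assumes "m \<noteq> n"
  shows "\<not> row m \<le>\<^sub>T row n"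
proof
  assume "row m \<le>\<^sub>T row n"
  then obtain e where e: "\<And>x. computes (Some \<circ> row n) e [x] (row m x)"
    by (auto simp: turing_le_def)
  define i where "i = prod_encode (prog_code e, prod_encode (n, m))"
  show False
  proof (cases "\<exists>w. good i (limit i) w")
    case True
    define w where "w = (LEAST w. good i (limit i) w)"
    define \<tau> where "\<tau> = list_decode (pi1 w)"
    have "good i (limit i) w"
      unfolding w_def using True by (rule LeastI_ex)
    then have req: "requirement i \<tau> (list_decode (pi2 w))"
      by (simp add: good_def \<tau>_def)
    have "limit (Suc i) = 0 # \<tau>"
      using True by (simp add: extend_limit_def \<tau>_def w_def)
    then have suf: "suffix \<tau> (limit (Suc i))"
      by (simp add: suffix_ConsI)
    obtain c where c: "c \<in> set (list_decode (pi2 w))" "claim_prog c = prog_code e"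
      "list_len (claim_args c) = 1" "prod_encode (m, list_nth (claim_args c) 0) < length \<tau>"
      "column \<tau> m (list_nth (claim_args c) 0) \<noteq> Some (claim_val c)"
      and der: "derivation (column \<tau> n) (list_decode (pi2 w))"
      using req by (auto simp: requirement_def i_def)
    \<comment> \<open>The answers used from \<open>\<tau>\<close> are true values of
      \<open>row n\<close>, so the refuting computation is genuine.\<close>
    have "derivation (Some \<circ> row n) (list_decode (pi2 w))"
      by (rule derivation_oracle_cong[OF der]) (auto dest: column_suffix_limit[OF suf])
    moreover obtain x where x: "claim_args c = list_encode [x]"
      using c(3) by (auto simp: list_len_def length_Suc_conv) (metis list_decode_inverse)
    moreover have "claim (prog_code e) (list_encode [x]) (claim_val c) \<in> set (list_decode (pi2 w))"
      using c(1,2) x by (metis claim_eq_iff)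
    ultimately have "computes (Some \<circ> row n) e [x] (claim_val c)"
      by (blast intro: derivation_sound)
    then have val: "claim_val c = row m x"
      using e computes_deterministic by blast
    have "column \<tau> m x = Some (row m x)"
      using c(4) x column_suffix_limit[OF suf, of m x] by (auto simp: column_def)
    then show False
      using c(5) x val by simp
  next
    case False
    \<comment> \<open>Since \<open>x \<le> prod_encode (m, x)\<close>, the position of
      \<open>x\<close> in row \<open>m\<close> lies outside \<open>limit i\<close> and is still
      free.\<close>
    define x where "x = length (limit i)"
    have "claim (prog_code e) (list_encode [x]) (row m x) \<in> derivable (Some \<circ> row n)"
      by (rule derivation_complete[OF e])
    then obtain P where P: "derivation (Some \<circ> row n) P"
      "claim (prog_code e) (list_encode [x]) (row m x) \<in> set P"
      by (auto simp: derivable_def)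
    \<comment> \<open>The position to be altered, together with every position of row
      \<open>n\<close> that the derivation may query; \<open>N\<close> bounds them all.\<close>
    define F where "F = insert (prod_encode (m, x))
      ((\<lambda>c. prod_encode (n, list_nth (claim_args c) 0)) ` set P)"
    obtain N where "\<forall>p\<in>F. p < N"
      using finite_nat_set_iff_bounded[of F] by (auto simp: F_def)
    then have N: "prod_encode (m, x) < N"
      "\<And>c. c \<in> set P \<Longrightarrow> prod_encode (n, list_nth (claim_args c) 0) < N"
      by (auto simp: F_def)
    \<comment> \<open>One changed value spoils the computed value at \<open>x\<close>. Row
      \<open>n\<close> is untouched because \<open>m \<noteq> n\<close>, so the derivation
      survives.\<close>
    define H where "H = generic(prod_encode (m, x) := Suc (row m x))"
    define \<tau> where "\<tau> = rev (map H [0..<N])"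
    have le: "x \<le> prod_encode (m, x)"
      by (rule le_prod_encode_2)
    have "rev (limit i) = map generic [0..<x]"
      by (rule nth_equalityI) (auto simp: x_def rev_limit_nth)
    also have "\<dots> = map H [0..<x]"
      using le by (auto simp: H_def)
    finally have "rev (limit i) = map H [0..<x]" .
    moreover have "[0..<N] = [0..<x] @ [x..<N]"
      using le N(1) by (metis le_trans less_imp_le_nat upt_add_eq_append le_add_diff_inverse zero_le)
    ultimately have "prefix (rev (limit i)) (rev \<tau>)"
      by (simp add: \<tau>_def)
    then have suf: "suffix (limit i) \<tau>"
      by (simp add: suffix_to_prefix)
    have "derivation (column \<tau> n) P"
      using assms N(2)
      by (intro derivation_oracle_cong[OF P(1)])
        (auto simp: column_def \<tau>_def H_def row_def prod_encode_eq)
    moreover have "column \<tau> m x = Some (Suc (row m x))"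
      using N(1) by (simp add: column_def \<tau>_def H_def)
    ultimately have "requirement i \<tau> P"
      unfolding requirement_def using P(2) N(1)
      by (auto simp: i_def \<tau>_def intro!: bexI[OF _ P(2)])
    then have "good i (limit i) (prod_encode (list_encode \<tau>, list_encode P))"
      using suf by (simp add: good_def)
    then show False
      using False by blast
  qed
qed

section \<open>Paths with witnesses\<close>

definition agrees :: "nat \<Rightarrow> nat \<Rightarrow> nat \<Rightarrow> (nat \<Rightarrow> nat) \<Rightarrow> bool" where
  "agrees s t n X \<longleftrightarrow> (\<forall>p<length (stage s t). pi1 p = n \<longrightarrow> stage_val s t p = X (pi2 p))"

text \<open>Only agreement on row \<open>n\<close> is asked for, which \<open>row n\<close> itself
  can check; the other rows of \<open>stage s t\<close> may still differ from those of
  \<open>limit s\<close>.\<close>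

definition modulus :: "nat \<Rightarrow> nat \<Rightarrow> nat" where
  "modulus n s = (LEAST t. s \<le> t \<and> agrees s t n (row n))"

definition path :: "nat \<Rightarrow> nat \<Rightarrow> nat" where
  "path n s = prod_encode (n, prod_encode (row n s, modulus n s))"

lemma agrees_eventually_row: "\<exists>t\<ge>s. agrees s t n (row n)"
proof -
  obtain t where t: "\<And>u. t \<le> u \<Longrightarrow> stage s u = limit s"
    using stage_eventually_limit by blast
  have "stage_val s (max s t) p = row n (pi2 p)"
    if "p < length (stage s (max s t))" "pi1 p = n" for p
  proof -
    have "prod_encode (n, pi2 p) = p"
      using that(2) by auto
    then show ?thesis
      using that(1) t[of "max s t"] by (simp add: stage_val row_def rev_limit_nth)
  qed
  then show ?thesis
    by (auto simp: agrees_def intro!: exI[of _ "max s t"])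
qed

text \<open>Even if \<open>stage s t\<close> has not converged, its part
  \<open>stage (Suc ?p) t\<close> has for large \<open>s\<close>, because \<open>t \<ge> s\<close>.
  Agreement then forces the true value at \<open>?p\<close>.\<close>

lemma agrees_unique:
  assumes "\<And>s. \<exists>t\<ge>s. agrees s t n X"
  shows "X = row n"
proof
  fix x
  let ?p = "prod_encode (n, x)"
  obtain t0 where t0: "\<And>t. t0 \<le> t \<Longrightarrow> stage (Suc ?p) t = limit (Suc ?p)"
    using stage_eventually_limit by blast
  \<comment> \<open>The first bound makes \<open>stage (Suc ?p) t\<close> part of
    \<open>stage s t\<close>; the second makes it equal to its limit.\<close>
  define s where "s = max (Suc ?p) t0"
  obtain t where t: "s \<le> t" "agrees s t n X"
    using assms by blast
  have eq: "stage (Suc ?p) t = limit (Suc ?p)"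
    using t0 t(1) by (simp add: s_def)
  have suf: "suffix (stage (Suc ?p) t) (stage s t)"
    by (rule suffix_stage) (simp add: s_def)
  have p: "?p < length (stage (Suc ?p) t)"
    unfolding eq using length_limit[of "Suc ?p"] by simp
  then have p': "?p < length (stage s t)"
    using suffix_length_le[OF suf] by simp
  have "X x = stage_val s t ?p"
    using t(2) p' by (simp add: agrees_def)
  also have "\<dots> = rev (limit (Suc ?p)) ! ?p"
    using suffix_rev_nth[OF suf p] stage_val[OF p'] by (simp only: eq)
  finally show "X x = row n x"
    by (simp add: row_def generic_def)
qed

section \<open>Turing equivalence of paths and rows\<close>

lemma turing_le_iff_recursive_in: "f \<le>\<^sub>T g \<longleftrightarrow> recursive_in (Some \<circ> g) [\<lambda>x. x] f"
  by (simp add: turing_le_def recursive_in_def)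

primrec subst_oracle :: "prog \<Rightarrow> prog \<Rightarrow> prog" where
  "subst_oracle p Zero = Zero"
| "subst_oracle p Succ = Succ"
| "subst_oracle p (Proj i) = Proj i"
| "subst_oracle p Oracle = p"
| "subst_oracle p (Comp e ds) = Comp (subst_oracle p e) (map (subst_oracle p) ds)"
| "subst_oracle p (PrimRec d e) = PrimRec (subst_oracle p d) (subst_oracle p e)"
| "subst_oracle p (Mu e) = Mu (subst_oracle p e)"

lemma computes_subst_oracle:
  assumes "computes A e xs y" and p: "\<And>x y. A x = Some y \<Longrightarrow> computes B p [x] y"
  shows "computes B (subst_oracle p e) xs y"
  using assms(1)
proof (induction rule: computes.induct)
  case (Comp xs ds ys e z)
  then show ?case
    by (auto intro!: computes.Comp[of _ _ _ ys] simp: list_all2_conv_all_nth)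
next
  case (Mu e n xs)
  then show ?case
    by (auto intro!: computes.Mu)
qed (auto intro: computes.intros p)

lemma turing_le_trans:
  assumes "f \<le>\<^sub>T g" "g \<le>\<^sub>T h"
  shows "f \<le>\<^sub>T h"
  using assms computes_subst_oracle[of "Some \<circ> g" _ _ _ "Some \<circ> h"]
  unfolding turing_le_def by (metis comp_apply option.inject)

lemma row_le_path: "row n \<le>\<^sub>T path n"
proof -
  have "recursive_in (Some \<circ> path n) [\<lambda>x. x] (\<lambda>x. pi1 (pi2 (path n x)))"
    by (intro recursive_in_pi1 recursive_in_pi2 recursive_in_oracle recursive_in_var) auto
  then show ?thesis
    by (simp add: turing_le_iff_recursive_in path_def)
qed

text \<open>The modulus is found by a search that is decidable in \<open>row n\<close> and halts by
  \<open>agrees_eventually_row\<close>; \<open>n\<close> enters as a constant.\<close>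

lemma path_le_row: "path n \<le>\<^sub>T row n"
proof -
  have "recursive_in (Some \<circ> row n) [\<lambda>x. x] (\<lambda>s. LEAST t. s \<le> t \<and> agrees s t n (row n))"
    unfolding agrees_def
  proof (intro recursive_in_Least recursive_list_intros recursive_in_length_stage
      recursive_in_stage_val recursive_in_oracle)
    show "\<exists>t. s \<le> t \<and> (\<forall>p<length (stage s t). pi1 p = n \<longrightarrow> stage_val s t p = row n (pi2 p))" for s
      using agrees_eventually_row[of s n] by (auto simp: agrees_def)
  qed (rule recursive_in_var; simp)+
  then have "recursive_in (Some \<circ> row n) [\<lambda>x. x] (modulus n)"
    by (simp add: modulus_def[abs_def])
  then have "recursive_in (Some \<circ> row n) [\<lambda>x. x] (path n)"
    unfolding path_def[abs_def]
    by (intro recursive_in_prod_encode recursive_in_const recursive_in_oracle) (auto intro: recursive_in_var)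
  then show ?thesis
    by (simp add: turing_le_iff_recursive_in)
qed

lemma paths_incomparable:
  assumes "m \<noteq> n"
  shows "\<not> path m \<le>\<^sub>T path n"
  using rows_incomparable[OF assms] row_le_path path_le_row turing_le_trans by blast

section \<open>The computable tree\<close>

text \<open>What the values of \<open>X\<close> below \<open>L\<close> reveal about \<open>h\<close> being the least \<open>t \<ge> s\<close> with
  \<open>agrees s t n X\<close>.\<close>

definition admissible :: "nat \<Rightarrow> nat \<Rightarrow> (nat \<Rightarrow> nat) \<Rightarrow> nat \<Rightarrow> nat \<Rightarrow> bool" where
  "admissible n L X s h \<longleftrightarrow> s \<le> h \<and>
    (\<forall>p<length (stage s h). pi1 p = n \<longrightarrow> pi2 p < L \<longrightarrow> stage_val s h p = X (pi2 p)) \<and>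
    (\<forall>t<h. s \<le> t \<longrightarrow>
      (\<exists>p<length (stage s t). pi1 p = n \<and> (L \<le> pi2 p \<or> stage_val s t p \<noteq> X (pi2 p))))"

definition path_tree :: "nat list set" where
  "path_tree = {\<sigma>. \<forall>s<length \<sigma>. pi1 (\<sigma> ! s) = pi1 (\<sigma> ! 0) \<and>
    admissible (pi1 (\<sigma> ! 0)) (length \<sigma>) (\<lambda>x. pi1 (pi2 (\<sigma> ! x))) s (pi2 (pi2 (\<sigma> ! s)))}"

text \<open>Less information is a weaker constraint: fewer positions must agree, and an unseen
  position counts as a possible disagreement. This makes the tree closed under prefixes.\<close>

lemma admissible_mono:
  assumes "admissible n L X s h" "L' \<le> L" "\<And>x. x < L' \<Longrightarrow> X x = Y x"
  shows "admissible n L' Y s h"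
  unfolding admissible_def
proof (intro conjI allI impI)
  show "s \<le> h"
    using assms(1) by (simp add: admissible_def)
  show "stage_val s h p = Y (pi2 p)"
    if "p < length (stage s h)" "pi1 p = n" "pi2 p < L'" for p
    using assms that by (auto simp: admissible_def)
  fix t assume "t < h" "s \<le> t"
  then obtain p where "p < length (stage s t)" "pi1 p = n" "L \<le> pi2 p \<or> stage_val s t p \<noteq> X (pi2 p)"
    using assms(1) by (auto simp: admissible_def)
  then show "\<exists>p<length (stage s t). pi1 p = n \<and> (L' \<le> pi2 p \<or> stage_val s t p \<noteq> Y (pi2 p))"
    using assms(2,3) by (intro exI[of _ p]) (metis le_trans not_le)
qed

lemma is_tree_path_tree: "is_tree path_tree"
  unfolding is_tree_def
proof (intro ballI allI impI)
  fix \<sigma> \<tau> assume \<sigma>: "\<sigma> \<in> path_tree" and "prefix \<tau> \<sigma>"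
  then obtain \<rho> where \<rho>: "\<sigma> = \<tau> @ \<rho>"
    by (auto simp: prefix_def)
  show "\<tau> \<in> path_tree"
    unfolding path_tree_def
  proof (intro CollectI allI impI)
    fix s assume s: "s < length \<tau>"
    then have "s < length \<sigma>" and eq: "\<tau> ! s = \<sigma> ! s" "\<tau> ! 0 = \<sigma> ! 0"
      by (auto simp: \<rho> nth_append)
    then have "pi1 (\<sigma> ! s) = pi1 (\<sigma> ! 0)"
      and adm: "admissible (pi1 (\<sigma> ! 0)) (length \<sigma>) (\<lambda>x. pi1 (pi2 (\<sigma> ! x))) s (pi2 (pi2 (\<sigma> ! s)))"
      using \<sigma> by (auto simp: path_tree_def)
    moreover have "admissible (pi1 (\<sigma> ! 0)) (length \<tau>) (\<lambda>x. pi1 (pi2 (\<tau> ! x))) s (pi2 (pi2 (\<sigma> ! s)))"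
      by (rule admissible_mono[OF adm]) (auto simp: \<rho> nth_append)
    ultimately show "pi1 (\<tau> ! s) = pi1 (\<tau> ! 0) \<and>
      admissible (pi1 (\<tau> ! 0)) (length \<tau>) (\<lambda>x. pi1 (pi2 (\<tau> ! x))) s (pi2 (pi2 (\<tau> ! s)))"
      by (simp add: eq)
  qed
qed

lemma computable_path_tree: "computable_strings path_tree"
proof -
  let ?adm = "\<lambda>q s. admissible (pi1 (list_nth q 0)) (list_len q) (\<lambda>x. pi1 (pi2 (list_nth q x))) s
      (pi2 (pi2 (list_nth q s)))"
  have "list_decode q \<in> path_tree \<longleftrightarrow>
      (\<forall>s<list_len q. pi1 (list_nth q s) = pi1 (list_nth q 0) \<and> ?adm q s)" for q
  proof -
    \<comment> \<open>\<open>admissible\<close> depends on its function only below the length, so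
      list access may be replaced by the total, recursive \<open>list_nth\<close>.\<close>
    have adm: "admissible n (list_len q) (\<lambda>x. pi1 (pi2 (list_decode q ! x))) s h \<longleftrightarrow>
        admissible n (list_len q) (\<lambda>x. pi1 (pi2 (list_nth q x))) s h" for n s h
      by (auto elim!: admissible_mono simp: list_nth_def)
    show ?thesis
      unfolding path_tree_def mem_Collect_eq list_len_def[symmetric]
    proof (rule all_cong)
      fix s assume s: "s < list_len q"
      then have "list_decode q ! s = list_nth q s" "list_decode q ! 0 = list_nth q 0"
        by (auto simp: list_nth_def)
      then show "(pi1 (list_decode q ! s) = pi1 (list_decode q ! 0) \<and>
          admissible (pi1 (list_decode q ! 0)) (list_len q) (\<lambda>x. pi1 (pi2 (list_decode q ! x))) s
            (pi2 (pi2 (list_decode q ! s)))) \<longleftrightarrow>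
          (pi1 (list_nth q s) = pi1 (list_nth q 0) \<and> ?adm q s)"
        by (simp add: adm)
    qed
  qed
  moreover have "decidable_in Map.empty [\<lambda>x. x]
      (\<lambda>q. \<forall>s<list_len q. pi1 (list_nth q s) = pi1 (list_nth q 0) \<and> ?adm q s)"
    unfolding admissible_def
    by (intro recursive_list_intros recursive_in_length_stage recursive_in_stage_val recursive_in_var; auto)
  ultimately have "decidable_in Map.empty [\<lambda>x. x] (\<lambda>q. list_decode q \<in> path_tree)"
    by simp
  then show ?thesis
    by (simp add: computable_strings_def computable_def decidable_in_def recursive_in_def of_bool_def)
qed

section \<open>The paths through the tree\<close>

lemma init_seg_iff: "init_seg \<sigma> f \<longleftrightarrow> \<sigma> = map f [0..<length \<sigma>]"
  unfolding init_seg_def by (subst list_eq_iff_nth_eq) simp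

lemma tree_paths_iff: "f \<in> tree_paths T \<longleftrightarrow> (\<forall>L. map f [0..<L] \<in> T)"
  unfolding tree_paths_def init_seg_iff by (auto, metis length_map length_upt diff_zero)

lemma pi2_le: "pi2 p \<le> p"
  using le_prod_encode_2[of "pi2 p" "pi1 p"] by simp

text \<open>Each stage is a finite string, so for large \<open>L\<close> all its positions are
  visible and a possible disagreement becomes an actual one.\<close>

lemma admissible_all_iff:
  "(\<forall>L>s. admissible n L X s h) \<longleftrightarrow>
    s \<le> h \<and> agrees s h n X \<and> (\<forall>t<h. s \<le> t \<longrightarrow> \<not> agrees s t n X)"
proof (intro iffI conjI allI impI)
  assume *: "\<forall>L>s. admissible n L X s h"
  then show "s \<le> h"
    by (auto simp: admissible_def)
  show "agrees s h n X"
    unfolding agrees_def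
  proof (intro allI impI)
    fix p assume "p < length (stage s h)" "pi1 p = n"
    then show "stage_val s h p = X (pi2 p)"
      using *[rule_format, of "Suc (max s (pi2 p))"] by (auto simp: admissible_def less_Suc_eq_le)
  qed
  fix t assume t: "t < h" "s \<le> t"
  \<comment> \<open>\<open>L\<close> exceeds \<open>s\<close>, as the assumption demands, and
    exceeds \<open>pi2 p\<close> for every position \<open>p\<close> of the stage.\<close>
  define L where "L = Suc (max s (length (stage s t)))"
  have "admissible n L X s h"
    using * by (simp add: L_def)
  then obtain p where p: "p < length (stage s t)" "pi1 p = n" "L \<le> pi2 p \<or> stage_val s t p \<noteq> X (pi2 p)"
    using t by (auto simp: admissible_def)
  have "pi2 p < L"
    using pi2_le[of p] p(1) by (simp add: L_def)
  then show "\<not> agrees s t n X"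
    using p by (auto simp: agrees_def)
qed (auto simp: admissible_def agrees_def)

lemma tree_paths_path_tree_iff:
  "f \<in> tree_paths path_tree \<longleftrightarrow>
    (\<forall>s. pi1 (f s) = pi1 (f 0) \<and>
      (\<forall>L>s. admissible (pi1 (f 0)) L (\<lambda>x. pi1 (pi2 (f x))) s (pi2 (pi2 (f s)))))"
proof -
  have *: "admissible n L (\<lambda>x. pi1 (pi2 (map f [0..<L] ! x))) s h \<longleftrightarrow>
      admissible n L (\<lambda>x. pi1 (pi2 (f x))) s h" for n L s h
    by (auto elim!: admissible_mono)
  have "map f [0..<L] ! 0 = f 0" if "s < L" for s L
    using that by simp
  then show ?thesis
    unfolding tree_paths_iff path_tree_def by (auto simp: *)
qed

text \<open>The first components along a path are a constant \<open>n\<close>; the second ones form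
  \<open>row n\<close> by \<open>agrees_unique\<close>; minimality then makes the third ones the
  modulus.\<close>

lemma tree_paths_path_tree: "tree_paths path_tree = range path"
proof (intro set_eqI iffI)
  fix f assume "f \<in> tree_paths path_tree"
  then have f: "pi1 (f s) = pi1 (f 0)" "s \<le> pi2 (pi2 (f s))"
    "agrees s (pi2 (pi2 (f s))) (pi1 (f 0)) (\<lambda>x. pi1 (pi2 (f x)))"
    "t < pi2 (pi2 (f s)) \<Longrightarrow> s \<le> t \<Longrightarrow> \<not> agrees s t (pi1 (f 0)) (\<lambda>x. pi1 (pi2 (f x)))" for s t
    unfolding tree_paths_path_tree_iff admissible_all_iff by blast+
  have row: "(\<lambda>x. pi1 (pi2 (f x))) = row (pi1 (f 0))"
    by (rule agrees_unique) (use f in blast)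
  have "pi2 (pi2 (f s)) = modulus (pi1 (f 0)) s" for s
    unfolding modulus_def
  proof (rule Least_equality[symmetric])
    show "s \<le> pi2 (pi2 (f s)) \<and> agrees s (pi2 (pi2 (f s))) (pi1 (f 0)) (row (pi1 (f 0)))"
      using f(2,3)[of s] by (simp add: row)
    show "pi2 (pi2 (f s)) \<le> t" if "s \<le> t \<and> agrees s t (pi1 (f 0)) (row (pi1 (f 0)))" for t
      using f(4)[of t s, unfolded row] that by (meson not_less)
  qed
  then have "f s = path (pi1 (f 0)) s" for s
    using f(1)[of s] fun_cong[OF row, of s] unfolding path_def by (metis prod_encode_pi)
  then have "f = path (pi1 (f 0))"
    by blast
  then show "f \<in> range path"
    by blast
next
  fix f assume "f \<in> range path"
  then obtain n where f: "f = path n"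
    by blast
  have mod: "s \<le> modulus n s \<and> agrees s (modulus n s) n (row n)" for s
    unfolding modulus_def by (rule LeastI_ex) (use agrees_eventually_row in blast)
  have "\<not> agrees s t n (row n)" if "t < modulus n s" "s \<le> t" for s t
    using that not_less_Least[of t "\<lambda>t. s \<le> t \<and> agrees s t n (row n)"] by (auto simp: modulus_def)
  with mod show "f \<in> tree_paths path_tree"
    unfolding tree_paths_path_tree_iff admissible_all_iff by (simp add: f path_def)
qed

section \<open>Closedness, non-compactness and conclusion\<close>

lemma openin_cylinder: "openin baire_topology (cylinder \<sigma>)"
  unfolding baire_topology_def by (rule topology_generated_by_Basis) auto

lemma closedin_tree_paths: "closedin baire_topology (tree_paths T)"
proof -
  have "- tree_paths T = \<Union> (cylinder ` (- T))"
    by (auto simp: tree_paths_def cylinder_def)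
  moreover have "openin baire_topology (\<Union> (cylinder ` (- T)))"
    by (rule openin_Union) (auto intro: openin_cylinder)
  ultimately show ?thesis
    by (simp add: closedin_def Compl_eq_Diff_UNIV)
qed

text \<open>The cylinders of strings of length one cover the space, and a finite subcover leaves
  only finitely many first values.\<close>

lemma compactin_finite_first_values:
  assumes "compactin baire_topology Q"
  shows "finite ((\<lambda>f. f 0) ` Q)"
proof -
  have "Q \<subseteq> \<Union> (range (\<lambda>k. cylinder [k]))"
    by (auto simp: cylinder_def init_seg_def)
  then obtain \<F> where \<F>: "finite \<F>" "\<F> \<subseteq> range (\<lambda>k. cylinder [k])" "Q \<subseteq> \<Union> \<F>"
    using compactinD[OF assms, of "range (\<lambda>k. cylinder [k])"] openin_cylinder by blast
  then obtain K where K: "finite K" "\<F> = (\<lambda>k. cylinder [k]) ` K"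
    using finite_subset_image by metis
  then have "(\<lambda>f. f 0) ` Q \<subseteq> K"
    using \<F>(3) by (auto simp: cylinder_def init_seg_def)
  then show ?thesis
    using K(1) finite_subset by blast
qed

theorem theorem1:
  shows "\<exists>Q :: (nat \<Rightarrow> nat) set.
    Q \<noteq> {} \<and> Pi01_class Q \<and> closedin baire_topology Q \<and>
    \<not> compactin baire_topology Q \<and>
    (\<forall>f\<in>Q. \<forall>g\<in>Q. f \<noteq> g \<longrightarrow> \<not> f \<le>\<^sub>T g)"
proof (intro exI[of _ "range path"] conjI)
  show "Pi01_class (range path)"
    unfolding Pi01_class_def
    using is_tree_path_tree computable_path_tree tree_paths_path_tree by metis
  show "closedin baire_topology (range path)"
    using closedin_tree_paths[of path_tree] by (simp add: tree_paths_path_tree)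
  show "\<not> compactin baire_topology (range path)"
  proof
    assume "compactin baire_topology (range path)"
    then have "finite (pi1 ` (\<lambda>f. f 0) ` range path)"
      by (intro finite_imageI compactin_finite_first_values)
    \<comment> \<open>The first value of \<open>path n\<close> has first component \<open>n\<close>,
      so infinitely many first values occur.\<close>
    moreover have "pi1 ` (\<lambda>f. f 0) ` range path = UNIV"
      by (auto simp: image_image path_def)
    ultimately show False
      by simp
  qed
  show "\<forall>f\<in>range path. \<forall>g\<in>range path. f \<noteq> g \<longrightarrow> \<not> f \<le>\<^sub>T g"
    using paths_incomparable by (metis rangeE)
qed simp

end
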